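(* For every integer $n\ge1$, $$\left\lfloor\left(\sum_{k=n}^\infty\frac{(-1)^k}{B_k^2}\right)^{-1}\right\rfloor=\begin{cases}B_n^2+B_{n-1}^2&\text{if $n$ is even},\\ -(B_n^2+B_{n-1}^2+1)&\text{if $n$ is odd}.\end{cases}$$
   Context: The balancing numbers are defined by $B_0=0$, $B_1=1$, $B_n=6B_{n-1}-B_{n-2}$ for $n\ge 2$. $\lfloor x\rfloor$ denotes the floor of a real number $x$. *)

theory Defs
  imports Complex_Main
begin

fun balancing :: "nat \<Rightarrow> int" where
  "balancing 0 = 0"
| "balancing (Suc 0) = 1"
| "balancing (Suc (Suc n)) = 6 * balancing (Suc n) - balancing n"

end

theory Submission
  imports Defs "HOL-Analysis.Summation_Tests"
begin

text \<open>Write \<open>c n\<close> for the sum of the squares of \<open>balancing n\<close> and \<open>balancing (n - 1)\<close>. Consecutive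
  balancing numbers \<open>x, y\<close> satisfy \<open>x\<^sup>2 - 6xy + y\<^sup>2 = 1\<close>. With \<open>t = x\<^sup>2 + y\<^sup>2\<close> this gives
  \<open>36x\<^sup>2y\<^sup>2 = t\<^sup>2 - 2t + 1\<close>, \<open>c n * c (n + 2) = t\<^sup>2 - 4t + 40\<close> and
  \<open>(c n + 1) * (c (n + 2) + 1) = t\<^sup>2 + 30t + 45\<close>, while
  \<open>c (n + 2) - c n = 36(y\<^sup>2 - x\<^sup>2)\<close>. Hence \<open>1/x\<^sup>2 - 1/y\<^sup>2\<close> lies strictly between
  \<open>1/(c n + 1) - 1/(c (n + 2) + 1)\<close> and \<open>1/c n - 1/c (n + 2)\<close>. Adding up the terms of the
  alternating series in pairs, both bounds telescope, so its absolute value lies strictly between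
  \<open>1/(c n + 1)\<close> and \<open>1/c n\<close>.\<close>

text \<open>Grouping a convergent series in pairs keeps its sum, and the bounding differences
  telescope to \<open>f 0\<close>. Strictness survives the limit because the difference of the two
  series has only positive terms.\<close>

lemma suminf_less_telescope_pairs:
  fixes b f :: "nat \<Rightarrow> real"
  assumes b: "summable b" and f: "f \<longlonglongrightarrow> 0"
    and less: "\<And>j. b (2 * j) + b (2 * j + 1) < f (2 * j) - f (2 * j + 2)"
  shows "suminf b < f 0"
proof -
  have "(\<lambda>j. sum b {j * 2..<j * 2 + 2}) sums suminf b"
    using sums_group[OF summable_sums[OF b], of 2] by simp
  then have pairs: "(\<lambda>j. b (2 * j) + b (2 * j + 1)) sums suminf b"
    by (simp add: numeral_2_eq_2 mult.commute)
  have "strict_mono (\<lambda>j::nat. 2 * j)"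
    by (simp add: strict_mono_def)
  from LIMSEQ_subseq_LIMSEQ[OF f this] have "(\<lambda>j. f (2 * j)) \<longlonglongrightarrow> 0"
    by (simp add: o_def)
  from telescope_sums'[OF this]
  have "(\<lambda>j. f (2 * j) - f (2 * j + 2)) sums f 0"
    by simp
  from sums_diff[OF this pairs]
  have diff: "(\<lambda>j. f (2 * j) - f (2 * j + 2) - (b (2 * j) + b (2 * j + 1))) sums (f 0 - suminf b)" .
  have "0 < (\<Sum>j. f (2 * j) - f (2 * j + 2) - (b (2 * j) + b (2 * j + 1)))"
    using less by (intro suminf_pos[OF sums_summable[OF diff]]) (simp add: algebra_simps)
  then show ?thesis
    using sums_unique[OF diff] by simp
qed

text \<open>The step from (x, y) to (y, 6y - x) preserves the form x^2 - 6xy + y^2, whose value at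
  (0, 1) is 1.\<close>

lemma balancing_norm:
  "(balancing n)\<^sup>2 - 6 * balancing n * balancing (Suc n) + (balancing (Suc n))\<^sup>2 = 1"
  by (induction n) (auto simp: power2_eq_square algebra_simps)

lemma balancing_less_Suc: "0 \<le> balancing n \<and> balancing n < balancing (Suc n)"
  by (induction n) auto

text \<open>Far from the true exponential growth, but enough for positivity, for comparison with
  1/k^2 and for divergence of \<open>balancing_sq_sum\<close>.\<close>

lemma le_balancing: "int n \<le> balancing n"
proof (induction n)
  case (Suc n)
  then show ?case using balancing_less_Suc[of n] by linarith
qed simp

definition balancing_sq_sum :: "nat \<Rightarrow> int" where
  "balancing_sq_sum n = (balancing n)\<^sup>2 + (balancing (n - 1))\<^sup>2"

lemma le_balancing_sq_sum: "int n \<le> balancing_sq_sum n"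
proof -
  have "int n \<le> balancing n"
    by (rule le_balancing)
  also have "\<dots> \<le> (balancing n)\<^sup>2"
    using balancing_less_Suc[of n] by (cases "balancing n = 0") (auto simp: power2_eq_square)
  finally show ?thesis
    by (simp add: balancing_sq_sum_def add_increasing2)
qed

text \<open>The outer neighbours of x, y are 6x - y and 6y - x, and the norm equation replaces 6xy
  by \<open>t\<close> - 1, so that product and sum become polynomials in \<open>t\<close>. Starting
  at \<open>Suc m\<close> avoids truncated subtraction.\<close>

lemma balancing_sq_sum_relations:
  fixes m :: nat
  defines "t \<equiv> (balancing (Suc m))\<^sup>2 + (balancing (m + 2))\<^sup>2"
  shows "36 * (balancing (Suc m))\<^sup>2 * (balancing (m + 2))\<^sup>2 = t\<^sup>2 - 2 * t + 1"
    and "balancing_sq_sum (Suc m) * balancing_sq_sum (m + 3) = t\<^sup>2 - 4 * t + 40"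
    and "balancing_sq_sum (Suc m) + balancing_sq_sum (m + 3) = 34 * t + 4"
    and "balancing_sq_sum (m + 3) - balancing_sq_sum (Suc m)
      = 36 * ((balancing (m + 2))\<^sup>2 - (balancing (Suc m))\<^sup>2)"
    and "37 \<le> t"
proof -
  define x where "x = balancing (Suc m)"
  define y where "y = balancing (m + 2)"
  have t: "t = x\<^sup>2 + y\<^sup>2"
    by (simp add: t_def x_def y_def)
  have norm: "6 * (x * y) = t - 1"
    using balancing_norm[of "Suc m"] by (simp add: t x_def y_def)
  have c1: "balancing_sq_sum (Suc m) = 35 * x\<^sup>2 - y\<^sup>2 + 2"
  proof -
    have m: "balancing m = 6 * x - y"
      by (simp add: x_def y_def)
    have "balancing_sq_sum (Suc m) = 37 * x\<^sup>2 - 2 * (6 * (x * y)) + y\<^sup>2"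
      unfolding balancing_sq_sum_def diff_Suc_1 m x_def[symmetric]
      by (simp add: power2_eq_square algebra_simps)
    then show ?thesis by (simp add: norm t)
  qed
  have c3: "balancing_sq_sum (m + 3) = 35 * y\<^sup>2 - x\<^sup>2 + 2"
  proof -
    have m3: "balancing (m + 3) = 6 * y - x" and pred: "m + 3 - 1 = m + 2"
      by (simp_all add: x_def y_def numeral_3_eq_3)
    have "balancing_sq_sum (m + 3) = 37 * y\<^sup>2 - 2 * (6 * (x * y)) + x\<^sup>2"
      unfolding balancing_sq_sum_def pred m3 y_def[symmetric]
      by (simp add: power2_eq_square algebra_simps)
    then show ?thesis by (simp add: norm t)
  qed
  have prod: "36 * (x\<^sup>2 * y\<^sup>2) = (t - 1)\<^sup>2"
    by (simp add: norm[symmetric] power_mult_distrib)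
  then show "36 * (balancing (Suc m))\<^sup>2 * (balancing (m + 2))\<^sup>2 = t\<^sup>2 - 2 * t + 1"
    unfolding x_def[symmetric] y_def[symmetric] by (simp add: power2_eq_square algebra_simps)
  \<comment> \<open>Expanding gives 1226 x^2 y^2 - 35 (x^4 + y^4) + ...; completing x^4 + y^4 to
    \<open>t\<close>^2 adds 70 x^2 y^2, hence the factor 36 * 36.\<close>
  have "balancing_sq_sum (Suc m) * balancing_sq_sum (m + 3)
      = 36 * (36 * (x\<^sup>2 * y\<^sup>2)) - 35 * t\<^sup>2 + 68 * t + 4"
    unfolding c1 c3 t by (simp add: power2_eq_square algebra_simps)
  also have "\<dots> = t\<^sup>2 - 4 * t + 40"
    unfolding prod by (simp add: power2_eq_square algebra_simps)
  finally show "balancing_sq_sum (Suc m) * balancing_sq_sum (m + 3) = t\<^sup>2 - 4 * t + 40" .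
  show "balancing_sq_sum (Suc m) + balancing_sq_sum (m + 3) = 34 * t + 4"
    by (simp add: c1 c3 t)
  show "balancing_sq_sum (m + 3) - balancing_sq_sum (Suc m)
      = 36 * ((balancing (m + 2))\<^sup>2 - (balancing (Suc m))\<^sup>2)"
    unfolding x_def[symmetric] y_def[symmetric] by (simp add: c1 c3)
  have x: "1 \<le> x"
    using le_balancing[of "Suc m"] by (simp add: x_def)
  \<comment> \<open>Here y = 6x - \<open>balancing m\<close> with \<open>balancing m\<close> < x, so
    y > 5x.\<close>
  have "6 \<le> y"
    using balancing_less_Suc[of m] x by (simp add: x_def y_def)
  then have "6\<^sup>2 \<le> y\<^sup>2" and "1\<^sup>2 \<le> x\<^sup>2"
    using x by (intro power_mono; simp)+
  then show "37 \<le> t"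
    by (simp add: t)
qed

text \<open>Over common denominators all three differences have the numerator 36(y^2 - x^2) = d - c,
  so only the denominators need comparing.\<close>

lemma inverse_sq_diff_bounds:
  fixes n :: nat
  assumes "1 \<le> n"
  defines "x \<equiv> real_of_int (balancing n)" and "y \<equiv> real_of_int (balancing (n + 1))"
    and "c \<equiv> real_of_int (balancing_sq_sum n)" and "d \<equiv> real_of_int (balancing_sq_sum (n + 2))"
  shows "1 / x\<^sup>2 - 1 / y\<^sup>2 < 1 / c - 1 / d"
    and "1 / (c + 1) - 1 / (d + 1) < 1 / x\<^sup>2 - 1 / y\<^sup>2"
proof -
  obtain m where n: "n = Suc m"
    using assms(1) by (cases n) auto
  have n1: "n + 1 = m + 2" and n2: "n + 2 = m + 3"
    by (simp_all add: n)
  define t where "t = x\<^sup>2 + y\<^sup>2"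
  have prod: "36 * x\<^sup>2 * y\<^sup>2 = t\<^sup>2 - 2 * t + 1" and cd: "c * d = t\<^sup>2 - 4 * t + 40"
    and sum: "c + d = 34 * t + 4" and diff: "d - c = 36 * (y\<^sup>2 - x\<^sup>2)"
    using balancing_sq_sum_relations(1-4)[of m, folded n n1 n2, THEN arg_cong[where f = real_of_int]]
    by (simp_all add: t_def x_def y_def c_def d_def)
  have t: "37 \<le> t"
    using balancing_sq_sum_relations(5)[of m, folded n n1 n2]
    unfolding t_def x_def y_def by (simp flip: of_int_power of_int_add)
  have x: "0 < x" and xy: "x < y"
    using le_balancing[of n] balancing_less_Suc[of n] assms(1) by (auto simp: x_def y_def)
  have sq: "0 < y\<^sup>2 - x\<^sup>2"
    using x xy by (simp add: power_strict_mono)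
  have c: "0 < c" and d: "0 < d"
    using le_balancing_sq_sum[of n] le_balancing_sq_sum[of "n + 2"] assms(1)
    by (auto simp: c_def d_def)
  have inv: "1 / x\<^sup>2 - 1 / y\<^sup>2 = 36 * (y\<^sup>2 - x\<^sup>2) / (36 * x\<^sup>2 * y\<^sup>2)"
    using x xy by (simp add: field_simps)
  \<comment> \<open>This amounts to 39 < 2t, which is where the lower bound on \<open>t\<close>
    enters.\<close>
  have "c * d < 36 * x\<^sup>2 * y\<^sup>2"
    using prod cd t by simp
  then have "36 * (y\<^sup>2 - x\<^sup>2) / (36 * x\<^sup>2 * y\<^sup>2) < 36 * (y\<^sup>2 - x\<^sup>2) / (c * d)"
    using sq c d x xy by (intro divide_strict_left_mono) (auto intro!: mult_pos_pos)
  also have "\<dots> = 1 / c - 1 / d"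
    unfolding diff[symmetric] using c d by (simp add: field_simps)
  finally show "1 / x\<^sup>2 - 1 / y\<^sup>2 < 1 / c - 1 / d"
    by (simp only: inv)
  have "36 * x\<^sup>2 * y\<^sup>2 < (c + 1) * (d + 1)"
    using prod cd sum t by (simp add: algebra_simps)
  then have "36 * (y\<^sup>2 - x\<^sup>2) / ((c + 1) * (d + 1)) < 36 * (y\<^sup>2 - x\<^sup>2) / (36 * x\<^sup>2 * y\<^sup>2)"
    using sq c d x xy by (intro divide_strict_left_mono) (auto intro!: mult_pos_pos)
  moreover have "36 * (y\<^sup>2 - x\<^sup>2) / ((c + 1) * (d + 1)) = 1 / (c + 1) - 1 / (d + 1)"
    unfolding diff[symmetric] using c d by (simp add: field_simps)
  ultimately show "1 / (c + 1) - 1 / (d + 1) < 1 / x\<^sup>2 - 1 / y\<^sup>2"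
    by (simp only: inv)
qed

lemma summable_alternating_inverse_balancing_sq:
  "summable (\<lambda>k. (- 1) ^ k / (real_of_int (balancing (n + k)))\<^sup>2)"
proof (rule summable_comparison_test')
  show "summable (\<lambda>k. inverse (real k ^ 2))"
    by (rule inverse_power_summable) simp
  fix k :: nat
  \<comment> \<open>At k = 0 the majorant is \<open>inverse 0\<close> = 0, so the comparison starts
    at 1.\<close>
  assume k: "1 \<le> k"
  have "real k \<le> real_of_int (balancing (n + k))"
    using le_balancing[of "n + k"] by linarith
  then have "(real k)\<^sup>2 \<le> (real_of_int (balancing (n + k)))\<^sup>2"
    by (intro power_mono) auto
  then show "norm ((- 1) ^ k / (real_of_int (balancing (n + k)))\<^sup>2) \<le> inverse (real k ^ 2)"
    using k by (simp add: inverse_eq_divide frac_le norm_divide norm_power)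
qed

lemma tendsto_inverse_balancing_sq_sum:
  assumes "0 \<le> a"
  shows "(\<lambda>k. 1 / (real_of_int (balancing_sq_sum (n + k)) + a)) \<longlonglongrightarrow> 0"
proof (rule tendsto_divide_0[OF tendsto_const], rule filterlim_at_top_imp_at_infinity)
  show "LIM k sequentially. real_of_int (balancing_sq_sum (n + k)) + a :> at_top"
  proof (rule filterlim_at_top_mono[OF filterlim_real_sequentially], rule always_eventually, rule allI)
    fix k
    show "real k \<le> real_of_int (balancing_sq_sum (n + k)) + a"
      using le_balancing_sq_sum[of "n + k"] assms by linarith
  qed
qed

text \<open>The sign is counted from the first term, so every pair starts with a positive term
  whatever the parity of \<open>n\<close>.\<close>

lemma alternating_inverse_balancing_sq_bounds:
  fixes n :: nat
  assumes n: "1 \<le> n"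
  defines "s \<equiv> \<Sum>k. (- 1) ^ k / (real_of_int (balancing (n + k)))\<^sup>2"
  shows "s < 1 / real_of_int (balancing_sq_sum n)"
    and "1 / (real_of_int (balancing_sq_sum n) + 1) < s"
proof -
  define b where "b k = (- 1) ^ k / (real_of_int (balancing (n + k)))\<^sup>2" for k
  have s: "s = suminf b" and b: "summable b"
    using summable_alternating_inverse_balancing_sq[of n] by (simp_all add: s_def b_def[abs_def])
  define f where "f a k = 1 / (real_of_int (balancing_sq_sum (n + k)) + a)" for a k
  have f: "f a \<longlonglongrightarrow> 0" if "0 \<le> a" for a
    using tendsto_inverse_balancing_sq_sum[OF that] by (simp add: f_def[abs_def])
  have pair: "b (2 * j) + b (2 * j + 1) < f 0 (2 * j) - f 0 (2 * j + 2)"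
    "f 1 (2 * j) - f 1 (2 * j + 2) < b (2 * j) + b (2 * j + 1)" for j
    using inverse_sq_diff_bounds[of "n + 2 * j"] n by (simp_all add: b_def f_def add.assoc)
  have "suminf b < f 0 0"
    by (rule suminf_less_telescope_pairs[OF b f pair(1)]) simp
  then show "s < 1 / real_of_int (balancing_sq_sum n)"
    by (simp add: s f_def)
  \<comment> \<open>Negating the series and the telescoping sequence turns the upper-bound lemma
    into a lower bound.\<close>
  have "(\<Sum>k. - b k) < - f 1 0"
  proof (rule suminf_less_telescope_pairs)
    show "summable (\<lambda>k. - b k)"
      using b by (rule summable_minus)
    show "(\<lambda>k. - f 1 k) \<longlonglongrightarrow> 0"
      using tendsto_minus[OF f[of 1]] by simp
    show "- b (2 * j) + - b (2 * j + 1) < - f 1 (2 * j) - - f 1 (2 * j + 2)" for j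
      using pair(2)[of j] by linarith
  qed
  then show "1 / (real_of_int (balancing_sq_sum n) + 1) < s"
    using suminf_minus[OF b] by (simp add: s f_def)
qed

theorem theorem6:
  fixes n :: nat
  assumes "n \<ge> 1"
  shows "\<lfloor>inverse (\<Sum>k. (- 1) ^ (n + k) / (real_of_int (balancing (n + k)))\<^sup>2)\<rfloor> =
    (if even n then (balancing n)\<^sup>2 + (balancing (n - 1))\<^sup>2
     else - ((balancing n)\<^sup>2 + (balancing (n - 1))\<^sup>2 + 1))"
proof -
  define s where "s = (\<Sum>k. (- 1) ^ k / (real_of_int (balancing (n + k)))\<^sup>2)"
  define c where "c = balancing_sq_sum n"
  have c: "0 < real_of_int c"
    using le_balancing_sq_sum[of n] assms by (simp add: c_def)
  have upper: "s < 1 / real_of_int c" and lower: "1 / (real_of_int c + 1) < s"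
    using alternating_inverse_balancing_sq_bounds[OF assms] by (simp_all add: s_def c_def)
  have s: "0 < s"
    using lower c by (smt (verit) divide_pos_pos)
  have bounds: "real_of_int c < inverse s" "inverse s < real_of_int c + 1"
    using upper lower c s by (simp_all add: field_simps)
  have "(\<Sum>k. (- 1) ^ (n + k) / (real_of_int (balancing (n + k)))\<^sup>2) = (- 1) ^ n * s"
    using suminf_mult[OF summable_alternating_inverse_balancing_sq[of n], of "(- 1) ^ n"]
    by (simp add: s_def power_add)
  \<comment> \<open>For odd \<open>n\<close> the value lies strictly between -(c + 1) and -c, which
    accounts for the extra 1 in that case.\<close>
  moreover have "\<lfloor>inverse s\<rfloor> = c" "\<lfloor>- inverse s\<rfloor> = - (c + 1)"
    using bounds by (simp_all add: floor_eq_iff)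
  ultimately show ?thesis
    by (simp add: c_def balancing_sq_sum_def)
qed

end
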